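(* Let $X$ be a finite $T_0$-space and let $A$ be a bp-retract of $X$. Let $r\colon X\to A$ be the corresponding retraction and let $i\colon A \to X$ be the inclusion map. (a) If $\mathrm{mxl}(X)\subseteq A$, then $\mathcal{U}(r)(C)=r(C)$ for all $C\in\mathcal{U}(X)$ and $\mathcal{U}(r)\,\mathcal{U}(i)=\mathrm{id}_{\mathcal{U}(A)}$. (b) If $A$ is a ubp-retract of $X$, then $\mathcal{U}(r)$ is a homeomorphism. (c) If $\mathrm{mxl}(X) \subseteq A$ and $A$ is a dbp-retract of $X$, then $\mathcal{U}(i)\,\mathcal{U}(r)\leq \mathrm{id}_{\mathcal{U}(X)}$.
   Context: A finite $T_0$-space is identified with a finite poset: $x\le y$ iff $U_x\subseteq U_y$, where $U_x=\{z\mid z\le x\}$ is the minimal open set containing $x$. Open sets are the down-sets, and continuous maps are the order-preserving maps; maps into a poset are compared pointwise. Let $\widehat U_x=U_x-\{x\}$ and $\widehat F_x=\{z\mid z>x\}$. A point $x\in X$ is a down beat point of $X$ if $\widehat U_x$ has a maximum, and an up beat point of $X$ if $\widehat F_x$ has a minimum. A subspace $A\subseteq X$ is a dbp-retract (resp. ubp-retract) of $X$ if $A$ can be obtained from $X$ by successively removing down beat points (resp. up beat points), one at a time, each being a down (resp. up) beat point of the subspace obtained at that stage (zero removals allowed). $A$ is a bp-retract of $X$ if it is a dbp-retract or a ubp-retract of $X$. With $i\colon A\to X$ the inclusion, the corresponding retraction is the unique continuous $r\colon X\to A$ with $ri=\mathrm{id}_A$ and $ir\le \mathrm{id}_X$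 if $A$ is a dbp-retract (resp. $ir\ge\mathrm{id}_X$ if $A$ is a ubp-retract). $\mathrm{mxl}(X)$ is the set of maximal elements of $X$. For a non-empty subset $B\subseteq X$ let $U_B=\bigcap_{b\in B}U_b$. $\mathcal{U}(X)$ is the set of all connected components of the non-empty sets $U_B$ with $\varnothing\ne B\subseteq \mathrm{mxl}(X)$, regarded as a poset (finite $T_0$-space) ordered by $\subseteq$. For a continuous map $f\colon X\to Y$ of finite $T_0$-spaces, $\mathcal{U}(f)\colon\mathcal{U}(X)\to\mathcal{U}(Y)$ is the continuous map $\mathcal{U}(f)(C)=\min\{D\in\mathcal{U}(Y)\mid f(C)\subseteq D\}$ (this minimum exists). *)

theory Defs
  imports "HOL-Analysis.Analysis"
begin

text \<open>A finite \<open>T\<^sub>0\<close>-space is a topology \<open>X\<close> with \<open>t0_space X\<close> and finite \<open>topspace X\<close>; a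
  subspace with carrier \<open>A\<close> is \<open>subtopology X A\<close>. In a finite space the intersection below is
  itself open, so it is the minimal open neighbourhood of \<open>x\<close>.\<close>

definition min_nbhd :: "'a topology \<Rightarrow> 'a \<Rightarrow> 'a set" where
  "min_nbhd X x = \<Inter> {U. openin X U \<and> x \<in> U}"

definition pt_le :: "'a topology \<Rightarrow> 'a \<Rightarrow> 'a \<Rightarrow> bool" where
  "pt_le X x y \<longleftrightarrow> x \<in> topspace X \<and> y \<in> topspace X \<and> min_nbhd X x \<subseteq> min_nbhd X y"

definition U_hat :: "'a topology \<Rightarrow> 'a \<Rightarrow> 'a set" where
  "U_hat X x = min_nbhd X x - {x}"

definition F_hat :: "'a topology \<Rightarrow> 'a \<Rightarrow> 'a set" where
  "F_hat X x = {z. pt_le X x z \<and> z \<noteq> x}"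

definition down_beat_point :: "'a topology \<Rightarrow> 'a \<Rightarrow> bool" where
  "down_beat_point X x \<longleftrightarrow>
     x \<in> topspace X \<and> (\<exists>m \<in> U_hat X x. \<forall>z \<in> U_hat X x. pt_le X z m)"

definition up_beat_point :: "'a topology \<Rightarrow> 'a \<Rightarrow> bool" where
  "up_beat_point X x \<longleftrightarrow>
     x \<in> topspace X \<and> (\<exists>m \<in> F_hat X x. \<forall>z \<in> F_hat X x. pt_le X m z)"

inductive dbp_retract :: "'a topology \<Rightarrow> 'a set \<Rightarrow> bool" for X where
  dbp_refl: "dbp_retract X (topspace X)"
| dbp_step: "dbp_retract X A \<Longrightarrow> down_beat_point (subtopology X A) x \<Longrightarrow> dbp_retract X (A - {x})"

inductive ubp_retract :: "'a topology \<Rightarrow> 'a set \<Rightarrow> bool" for X where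
  ubp_refl: "ubp_retract X (topspace X)"
| ubp_step: "ubp_retract X A \<Longrightarrow> up_beat_point (subtopology X A) x \<Longrightarrow> ubp_retract X (A - {x})"

definition bp_retract :: "'a topology \<Rightarrow> 'a set \<Rightarrow> bool" where
  "bp_retract X A \<longleftrightarrow> dbp_retract X A \<or> ubp_retract X A"

text \<open>The retraction corresponding to a bp-retract is given by its characterizing property; it is
  determined only on \<open>topspace X\<close>. The inclusion map is \<open>id\<close>. A set \<open>A\<close> can be both a dbp-retract
  and a ubp-retract, with different retractions (remove the middle point of a three-element chain);
  either one then counts as a corresponding retraction.\<close>

definition bp_retraction :: "'a topology \<Rightarrow> 'a set \<Rightarrow> ('a \<Rightarrow> 'a) \<Rightarrow> bool" where
  "bp_retraction X A r \<longleftrightarrow>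
     retraction_maps X (subtopology X A) r id \<and>
     (dbp_retract X A \<and> (\<forall>x \<in> topspace X. pt_le X (r x) x) \<or>
      ubp_retract X A \<and> (\<forall>x \<in> topspace X. pt_le X x (r x)))"

definition mxl :: "'a topology \<Rightarrow> 'a set" where
  "mxl X = {x \<in> topspace X. \<forall>y. pt_le X x y \<longrightarrow> y = x}"

definition U_set :: "'a topology \<Rightarrow> 'a set \<Rightarrow> 'a set" where
  "U_set X B = (\<Inter>b\<in>B. min_nbhd X b)"

definition UU :: "'a topology \<Rightarrow> 'a set set" where
  "UU X = {C. \<exists>B. B \<noteq> {} \<and> B \<subseteq> mxl X \<and> U_set X B \<noteq> {} \<and>
                  C \<in> connected_components_of (subtopology X (U_set X B))}"

definition downset_topology :: "'a set set \<Rightarrow> 'a set topology" where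
  "downset_topology P =
     topology (\<lambda>S. S \<subseteq> P \<and> (\<forall>C\<in>S. \<forall>D\<in>P. D \<subseteq> C \<longrightarrow> D \<in> S))"

lemma openin_downset_topology:
  "openin (downset_topology P) S \<longleftrightarrow> S \<subseteq> P \<and> (\<forall>C\<in>S. \<forall>D\<in>P. D \<subseteq> C \<longrightarrow> D \<in> S)"
proof -
  have "istopology (\<lambda>S. S \<subseteq> P \<and> (\<forall>C\<in>S. \<forall>D\<in>P. D \<subseteq> C \<longrightarrow> D \<in> S))"
    unfolding istopology_def by blast
  then show ?thesis
    by (simp add: downset_topology_def)
qed

lemma topspace_downset_topology: "topspace (downset_topology P) = P"
  unfolding topspace_def openin_downset_topology by blast

definition UU_space :: "'a topology \<Rightarrow> 'a set topology" where
  "UU_space X = downset_topology (UU X)"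

definition UU_map :: "'a topology \<Rightarrow> 'b topology \<Rightarrow> ('a \<Rightarrow> 'b) \<Rightarrow> 'a set \<Rightarrow> 'b set" where
  "UU_map X Y f C = (LEAST D. D \<in> UU Y \<and> f ` C \<subseteq> D)"

end

theory Submission
  imports Defs
begin

text \<open>
  Everything rests on one observation: if \<open>r\<close> fixes the maximal points, then it respects
  the pieces of which \<open>UU X\<close> is made. Suppose \<open>B \<subseteq> mxl X\<close> and
  \<open>C\<close> is a component of \<open>U_set X B\<close>. A point below every \<open>b \<in> B\<close>
  is sent by the monotone map \<open>r\<close> to a point below every \<open>r b = b\<close>, so \<open>r\<close>
  maps \<open>U_set X B\<close> into itself. As \<open>r x\<close> is comparable with \<open>x\<close>, it
  stays in the component of \<open>x\<close>. Hence \<open>r ` C = C \<inter> A\<close>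
  (\<open>image_component_eq_Int\<close>). This set is connected, being a continuous image of \<open>C\<close>,
  and so it is a component of \<open>U_set X B \<inter> A\<close>. Since \<open>A\<close> and \<open>X\<close>
  have the same maximal points, it belongs to \<open>UU\<close> of the subspace \<open>A\<close>. So the map
  induced by \<open>r\<close> is \<open>C \<mapsto> C \<inter> A\<close>.

  The map induced by the inclusion sends \<open>D\<close> to the least member \<open>E\<close> of \<open>UU X\<close>
  containing \<open>D\<close>, and \<open>E \<inter> A = D\<close> because \<open>E \<inter> A\<close> is connected and
  lies in the intersection of which \<open>D\<close> is a component. This is the second half of (a), and (c)
  is the leastness of \<open>E\<close> applied to \<open>D = C \<inter> A \<subseteq> C\<close>.

  For (b), removing up beat points never removes a maximal point, so the above applies and
  \<open>C \<mapsto> C \<inter> A\<close> is a monotone surjection; what remains is that it reflects the order.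
  Each \<open>x\<close> has a least point \<open>a\<close> of \<open>A\<close> above it
  (\<open>ubp_retract_least_above\<close>), and \<open>a\<close> lies in the same component as
  \<open>x\<close>. If \<open>C \<inter> A \<subseteq> D\<close>, every point of \<open>C\<close> thus lies below a point of
  \<open>D\<close>, which puts \<open>C\<close> inside the down-set of which \<open>D\<close> is a component, and
  so inside \<open>D\<close>, since \<open>C\<close> is connected and meets \<open>D\<close>.

  How \<open>r\<close> moves points enters only through the comparability of \<open>r x\<close> and
  \<open>x\<close>, so both kinds of retraction are treated at once. One \<open>A\<close> can be a retract of
  both kinds: in (b) the given \<open>r\<close> may be the one that moves points down, which is why the
  points \<open>a\<close> above are obtained from the removals and not as values of \<open>r\<close>.
\<close>

section \<open>The specialization order\<close>

lemma pt_le_iff: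
  "pt_le X x y \<longleftrightarrow> x \<in> topspace X \<and> y \<in> topspace X \<and> (\<forall>U. openin X U \<and> y \<in> U \<longrightarrow> x \<in> U)"
  unfolding pt_le_def min_nbhd_def by blast

lemma pt_le_trans: "pt_le X x y \<Longrightarrow> pt_le X y z \<Longrightarrow> pt_le X x z"
  by (auto simp: pt_le_def)

lemma pt_le_antisym:
  assumes "t0_space X" and "pt_le X x y" and "pt_le X y x"
  shows "x = y"
proof (rule ccontr)
  assume "x \<noteq> y"
  then obtain U where "openin X U" "x \<notin> U \<longleftrightarrow> y \<in> U"
    using assms(1)[unfolded t0_space_def] assms(2) unfolding pt_le_iff by metis
  then show False using assms(2,3) unfolding pt_le_iff by auto
qed

lemma pt_le_subtopology:
  "pt_le (subtopology X A) x y \<longleftrightarrow> x \<in> A \<and> y \<in> A \<and> pt_le X x y"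
  unfolding pt_le_iff openin_subtopology topspace_subtopology by blast

lemma pt_le_continuous_map:
  assumes "continuous_map X Y f" and "pt_le X x y"
  shows "pt_le Y (f x) (f y)"
  unfolding pt_le_iff
proof (intro conjI allI impI)
  have le: "x \<in> topspace X" "y \<in> topspace X" "\<And>U. openin X U \<Longrightarrow> y \<in> U \<Longrightarrow> x \<in> U"
    using assms(2) by (auto simp: pt_le_iff)
  show "f x \<in> topspace Y" "f y \<in> topspace Y"
    using assms(1) le by (auto simp: continuous_map_def)
  show "f x \<in> V" if "openin Y V \<and> f y \<in> V" for V
    using le(3)[OF openin_continuous_map_preimage[OF assms(1), of V]] le(2) that by simp
qed

lemma connectedin_comparable:
  assumes "pt_le X x y"
  shows "connectedin X {x, y}"
proof -
  have "x \<in> topspace X" "y \<in> topspace X" and le: "\<And>U. openin X U \<Longrightarrow> y \<in> U \<Longrightarrow> x \<in> U"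
    using assms by (auto simp: pt_le_iff)
  moreover have "\<not> (openin X U \<and> openin X V \<and> {x, y} \<subseteq> U \<union> V \<and>
      U \<inter> V \<inter> {x, y} = {} \<and> U \<inter> {x, y} \<noteq> {} \<and> V \<inter> {x, y} \<noteq> {})" for U V
    using le[of U] le[of V] by auto
  ultimately show ?thesis
    unfolding connectedin by simp
qed

lemma mem_min_nbhd_iff:
  assumes "y \<in> topspace X"
  shows "x \<in> min_nbhd X y \<longleftrightarrow> pt_le X x y"
  using assms unfolding min_nbhd_def pt_le_iff by blast

lemma mxl_subset_topspace: "mxl X \<subseteq> topspace X"
  by (auto simp: mxl_def)

lemma mem_U_set_iff:
  assumes "B \<subseteq> mxl X"
  shows "x \<in> U_set X B \<longleftrightarrow> (\<forall>b\<in>B. pt_le X x b)"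
  using assms mxl_subset_topspace[of X] by (auto simp: U_set_def mem_min_nbhd_iff subset_iff)

lemma U_set_subset_topspace:
  assumes "B \<noteq> {}" and "B \<subseteq> mxl X"
  shows "U_set X B \<subseteq> topspace X"
  using assms by (auto simp: mem_U_set_iff pt_le_def)

lemma exists_maximal_above:
  assumes "finite (topspace X)" and "t0_space X" and "x \<in> topspace X"
  shows "\<exists>m \<in> mxl X. pt_le X x m"
proof -
  let ?S = "{y. pt_le X x y}"
  have "?S \<subseteq> topspace X" by (auto simp: pt_le_def)
  then have fin: "finite (min_nbhd X ` ?S)"
    using assms(1) by (blast intro: finite_subset)
  have "x \<in> ?S"
    using assms(3) by (simp add: pt_le_def)
  then have "min_nbhd X ` ?S \<noteq> {}" by blast
  from finite_has_maximal[OF fin this] obtain m where m: "pt_le X x m"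
    and max: "\<forall>y. pt_le X x y \<longrightarrow> min_nbhd X m \<subseteq> min_nbhd X y \<longrightarrow> min_nbhd X m = min_nbhd X y"
    by auto
  have "y = m" if "pt_le X m y" for y
  proof -
    have "min_nbhd X m = min_nbhd X y"
      using max pt_le_trans[OF m that] that by (simp add: pt_le_def)
    then have "pt_le X y m" using that by (simp add: pt_le_def)
    then show ?thesis using assms(2) that by (simp add: pt_le_antisym)
  qed
  then have "m \<in> mxl X" using m by (auto simp: mxl_def pt_le_def)
  then show ?thesis using m by blast
qed

section \<open>Components of intersections of minimal neighbourhoods\<close>

lemma exists_component_superset:
  assumes B: "B \<noteq> {}" "B \<subseteq> mxl X"
    and D: "connectedin X D" "D \<noteq> {}" "D \<subseteq> U_set X B"
  obtains C where "C \<in> UU X" "connectedin X C" "D \<subseteq> C" "C \<subseteq> U_set X B"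
proof -
  let ?Y = "subtopology X (U_set X B)"
  obtain d where d: "d \<in> D" using D by blast
  let ?C = "connected_component_of_set ?Y d"
  have DY: "connectedin ?Y D" using D by (simp add: connectedin_subtopology)
  have "d \<in> topspace ?Y" using DY d connectedin_subset_topspace by blast
  then have "?C \<in> connected_components_of ?Y" by (auto simp: connected_components_of_def)
  then have "?C \<in> UU X" using B d D unfolding UU_def by blast
  moreover have "D \<subseteq> ?C" using DY d connected_component_of_maximal by metis
  moreover have "connectedin X ?C" "?C \<subseteq> U_set X B"
    using connectedin_connected_component_of[of ?Y d] by (auto simp: connectedin_subtopology)
  ultimately show thesis using that by blast
qed

text \<open>Together with the elimination rule below, this replaces components of a varying subspace by
  maximality among the connected subsets of the single space \<open>X\<close>.\<close>
lemma UU_I: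
  assumes B: "B \<noteq> {}" "B \<subseteq> mxl X"
    and C: "connectedin X C" "C \<noteq> {}" "C \<subseteq> U_set X B"
    and max: "\<And>S. connectedin X S \<Longrightarrow> C \<subseteq> S \<Longrightarrow> S \<subseteq> U_set X B \<Longrightarrow> S \<subseteq> C"
  shows "C \<in> UU X"
proof -
  obtain K where K: "K \<in> UU X" "connectedin X K" "C \<subseteq> K" "K \<subseteq> U_set X B"
    using exists_component_superset[OF B C] .
  then have "K = C" using max[of K] by blast
  then show ?thesis using K by simp
qed

lemma UU_E:
  assumes "C \<in> UU X"
  obtains B where "B \<noteq> {}" "B \<subseteq> mxl X" "connectedin X C" "C \<noteq> {}" "C \<subseteq> U_set X B"
    "\<And>S. connectedin X S \<Longrightarrow> S \<inter> C \<noteq> {} \<Longrightarrow> S \<subseteq> U_set X B \<Longrightarrow> S \<subseteq> C"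
proof -
  obtain B where B: "B \<noteq> {}" "B \<subseteq> mxl X"
    and C: "C \<in> connected_components_of (subtopology X (U_set X B))"
    using assms unfolding UU_def by blast
  have "connectedin (subtopology X (U_set X B)) C"
    using C by (rule connectedin_connected_components_of)
  then have "connectedin X C" "C \<subseteq> U_set X B" by (auto simp: connectedin_subtopology)
  moreover have "C \<noteq> {}" using C by (rule nonempty_connected_components_of)
  moreover have "S \<subseteq> C" if "connectedin X S" "S \<inter> C \<noteq> {}" "S \<subseteq> U_set X B" for S
    using connected_components_of_maximal[OF C, of S] that
    by (auto simp: connectedin_subtopology disjnt_def)
  ultimately show thesis using that B by blast
qed

text \<open>Among the index sets \<open>B\<close> with \<open>D \<subseteq> U_set X B\<close> there is a largest one,
  namely all maximal points above all of \<open>D\<close>. It gives the smallest intersection, and the component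
  of this intersection around \<open>D\<close> is contained in every other candidate. The set \<open>C0\<close>
  guarantees that the largest index set is not empty.\<close>
lemma UU_least_superset:
  assumes D: "connectedin X D" "D \<noteq> {}" and C0: "C0 \<in> UU X" "D \<subseteq> C0"
  obtains E where "E \<in> UU X" "D \<subseteq> E" "\<forall>C \<in> UU X. D \<subseteq> C \<longrightarrow> E \<subseteq> C"
proof -
  let ?B = "{b \<in> mxl X. \<forall>d\<in>D. pt_le X d b}"
  have sub: "B \<subseteq> ?B" if "B \<subseteq> mxl X" "D \<subseteq> U_set X B" for B
    using that by (auto simp: mem_U_set_iff[OF that(1)])
  obtain B0 where B0: "B0 \<noteq> {}" "B0 \<subseteq> mxl X" "C0 \<subseteq> U_set X B0"
    using C0(1) by (rule UU_E)
  then have "B0 \<subseteq> ?B" using sub[of B0] C0(2) by blast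
  then have ne: "?B \<noteq> {}" using B0(1) by blast
  have mx: "?B \<subseteq> mxl X" by blast
  have DB: "D \<subseteq> U_set X ?B" using mx by (auto simp: mem_U_set_iff[OF mx])
  obtain E where E: "E \<in> UU X" "connectedin X E" "D \<subseteq> E" "E \<subseteq> U_set X ?B"
    using exists_component_superset[OF ne mx D DB] .
  have "E \<subseteq> C" if "C \<in> UU X" "D \<subseteq> C" for C
    using \<open>C \<in> UU X\<close>
  proof (rule UU_E)
    fix B assume B: "B \<subseteq> mxl X" "C \<subseteq> U_set X B"
      and max: "\<And>S. connectedin X S \<Longrightarrow> S \<inter> C \<noteq> {} \<Longrightarrow> S \<subseteq> U_set X B \<Longrightarrow> S \<subseteq> C"
    have "B \<subseteq> ?B" using sub[of B] B that by blast
    then have "U_set X ?B \<subseteq> U_set X B" unfolding U_set_def by (rule INF_superset_mono) simp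
    then have "E \<subseteq> U_set X B" using E(4) by (rule order_trans[rotated])
    moreover have "E \<inter> C \<noteq> {}" using E(3) D(2) that(2) by auto
    ultimately show "E \<subseteq> C" using max[OF E(2)] by simp
  qed
  then show thesis using that[OF E(1,3)] by simp
qed

lemma UU_map_eqI:
  assumes "D \<in> UU Y" and "f ` C \<subseteq> D" and "\<And>E. E \<in> UU Y \<Longrightarrow> f ` C \<subseteq> E \<Longrightarrow> D \<subseteq> E"
  shows "UU_map X Y f C = D"
  unfolding UU_map_def using assms by (intro Least_equality) auto

section \<open>Retractions that fix the maximal points\<close>

text \<open>The common part of the two kinds of retraction: the direction in which \<open>r\<close> moves a
  point may even vary with the point.\<close>
locale comparable_retraction =
  fixes X :: "'a topology" and A :: "'a set" and r :: "'a \<Rightarrow> 'a"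
  assumes fin: "finite (topspace X)" and t0: "t0_space X"
    and cont: "continuous_map X (subtopology X A) r"
    and fixes_A: "\<And>a. a \<in> A \<Longrightarrow> r a = a"
    and comparable: "\<And>x. x \<in> topspace X \<Longrightarrow> pt_le X (r x) x \<or> pt_le X x (r x)"
    and mxl_sub: "mxl X \<subseteq> A"
begin

lemma mxl_subtopology_eq: "mxl (subtopology X A) = mxl X"
proof
  show "mxl X \<subseteq> mxl (subtopology X A)"
    using mxl_sub by (auto simp: mxl_def pt_le_subtopology)
  show "mxl (subtopology X A) \<subseteq> mxl X"
  proof
    fix a assume a: "a \<in> mxl (subtopology X A)"
    then have "a \<in> A" "a \<in> topspace X" by (auto simp: mxl_def)
    then obtain m where m: "m \<in> mxl X" "pt_le X a m"
      using exists_maximal_above[OF fin t0] by blast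
    then have "m = a"
      using a \<open>a \<in> A\<close> mxl_sub by (auto simp: mxl_def pt_le_subtopology)
    then show "a \<in> mxl X" using m by simp
  qed
qed

lemma U_set_subtopology_eq:
  assumes "B \<noteq> {}" and "B \<subseteq> mxl X"
  shows "U_set (subtopology X A) B = U_set X B \<inter> A"
proof (rule set_eqI)
  fix x
  have "B \<subseteq> A" using assms mxl_sub by blast
  then show "x \<in> U_set (subtopology X A) B \<longleftrightarrow> x \<in> U_set X B \<inter> A"
    using assms mem_U_set_iff[of B X x] mem_U_set_iff[of B "subtopology X A" x]
    by (auto simp: mxl_subtopology_eq pt_le_subtopology)
qed

lemma retraction_in_U_set:
  assumes B: "B \<noteq> {}" "B \<subseteq> mxl X" and x: "x \<in> U_set X B"
  shows "r x \<in> U_set X B \<inter> A"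
proof -
  have "pt_le X (r x) b \<and> r x \<in> A" if "b \<in> B" for b
  proof -
    have "b \<in> A" "pt_le X x b" using that B x mxl_sub by (auto simp: mem_U_set_iff[OF B(2)])
    then show ?thesis
      using pt_le_continuous_map[OF cont] fixes_A by (metis pt_le_subtopology)
  qed
  then show ?thesis using B(1) by (auto simp: mem_U_set_iff[OF B(2)])
qed

text \<open>The two-point set \<open>{x, r x}\<close> is connected and stays in the intersection of which
  \<open>C\<close> is a component, so \<open>r\<close> maps \<open>C\<close> into itself.\<close>
lemma image_component_eq_Int:
  assumes "C \<in> UU X"
  shows "r ` C = C \<inter> A"
  using assms
proof (rule UU_E)
  fix B assume B: "B \<noteq> {}" "B \<subseteq> mxl X" and CB: "C \<subseteq> U_set X B"
    and max: "\<And>S. connectedin X S \<Longrightarrow> S \<inter> C \<noteq> {} \<Longrightarrow> S \<subseteq> U_set X B \<Longrightarrow> S \<subseteq> C"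
  have "r x \<in> C \<inter> A" if "x \<in> C" for x
  proof -
    have rx: "r x \<in> U_set X B" "r x \<in> A" and x: "x \<in> U_set X B"
      using retraction_in_U_set[OF B] that CB by blast+
    have "connectedin X {x, r x}"
      using comparable[of x] x U_set_subset_topspace[OF B] connectedin_comparable
      by (metis insert_commute subsetD)
    then have "{x, r x} \<subseteq> C" using max that x rx by blast
    then show ?thesis using rx by blast
  qed
  moreover have "C \<inter> A \<subseteq> r ` C" using fixes_A by force
  ultimately show ?thesis by blast
qed

lemma connectedin_component_Int:
  assumes "C \<in> UU X"
  shows "connectedin (subtopology X A) (C \<inter> A)"
  using assms connectedin_continuous_map_image[OF cont] image_component_eq_Int
  by (metis UU_E)

text \<open>A connected subset of \<open>U_set X B \<inter> A\<close> that meets \<open>C\<close> is already absorbed by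
  \<open>C\<close>, so \<open>C \<inter> A\<close> is maximal among these.\<close>
lemma component_Int_in_UU:
  assumes "C \<in> UU X"
  shows "C \<inter> A \<in> UU (subtopology X A)"
  using assms
proof (rule UU_E)
  fix B assume B: "B \<noteq> {}" "B \<subseteq> mxl X" and C: "C \<noteq> {}" "C \<subseteq> U_set X B"
    and max: "\<And>S. connectedin X S \<Longrightarrow> S \<inter> C \<noteq> {} \<Longrightarrow> S \<subseteq> U_set X B \<Longrightarrow> S \<subseteq> C"
  have ne: "C \<inter> A \<noteq> {}" using image_component_eq_Int[OF assms] C by blast
  show ?thesis
  proof (rule UU_I)
    show "B \<noteq> {}" "B \<subseteq> mxl (subtopology X A)" "C \<inter> A \<noteq> {}"
      "connectedin (subtopology X A) (C \<inter> A)" "C \<inter> A \<subseteq> U_set (subtopology X A) B"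
      using B C ne assms connectedin_component_Int
      by (auto simp: mxl_subtopology_eq U_set_subtopology_eq)
    fix S assume "connectedin (subtopology X A) S" "C \<inter> A \<subseteq> S" "S \<subseteq> U_set (subtopology X A) B"
    then show "S \<subseteq> C \<inter> A"
      using max[of S] ne B by (auto simp: connectedin_subtopology U_set_subtopology_eq)
  qed
qed

lemma UU_map_retraction_eq_Int:
  assumes "C \<in> UU X"
  shows "UU_map X (subtopology X A) r C = C \<inter> A"
  using assms component_Int_in_UU image_component_eq_Int by (intro UU_map_eqI) auto

text \<open>The least member of \<open>UU X\<close> containing \<open>D\<close> adds no points of \<open>A\<close>: its trace
  on \<open>A\<close> is connected and contained in the intersection of which \<open>D\<close> is a
  component.\<close>
lemma UU_map_inclusion_least:
  assumes D: "D \<in> UU (subtopology X A)"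
  shows "UU_map (subtopology X A) X id D \<in> UU X"
    and "D = UU_map (subtopology X A) X id D \<inter> A"
    and "\<And>C. C \<in> UU X \<Longrightarrow> D \<subseteq> C \<Longrightarrow> UU_map (subtopology X A) X id D \<subseteq> C"
proof -
  let ?M = "UU_map (subtopology X A) X id D"
  obtain B where B: "B \<noteq> {}" "B \<subseteq> mxl X"
    and DA: "connectedin (subtopology X A) D" "D \<noteq> {}" "D \<subseteq> U_set X B \<inter> A"
    and max: "\<And>S. connectedin (subtopology X A) S \<Longrightarrow> S \<inter> D \<noteq> {} \<Longrightarrow> S \<subseteq> U_set X B \<inter> A \<Longrightarrow> S \<subseteq> D"
    using D by (rule UU_E) (metis U_set_subtopology_eq mxl_subtopology_eq)
  have DX: "connectedin X D" using DA by (simp add: connectedin_subtopology)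
  have DB: "D \<subseteq> U_set X B" using DA by blast
  obtain C where C: "C \<in> UU X" "connectedin X C" "D \<subseteq> C" "C \<subseteq> U_set X B"
    using exists_component_superset[OF B DX DA(2) DB] .
  obtain E where E: "E \<in> UU X" "D \<subseteq> E" "\<forall>C \<in> UU X. D \<subseteq> C \<longrightarrow> E \<subseteq> C"
    using UU_least_superset[OF DX DA(2) C(1,3)] .
  have M: "?M = E" using E by (intro UU_map_eqI) auto
  show "?M \<in> UU X" using M E by simp
  show "?M \<subseteq> C" if "C \<in> UU X" "D \<subseteq> C" for C using M E that by simp
  have "E \<subseteq> C" using E(3) C by simp
  then have "E \<inter> A \<subseteq> D"
    using max[OF connectedin_component_Int[OF E(1)]] C(4) E(2) DA by blast
  then show "D = ?M \<inter> A" using M E DA by blast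
qed

end

section \<open>Removing up beat points\<close>

lemma dbp_retract_subset: "dbp_retract X A \<Longrightarrow> A \<subseteq> topspace X"
  by (induction rule: dbp_retract.induct) auto

lemma ubp_retract_subset: "ubp_retract X A \<Longrightarrow> A \<subseteq> topspace X"
  by (induction rule: ubp_retract.induct) auto

text \<open>The map \<open>x \<mapsto> a\<close> is the upward retraction. When a beat point \<open>p\<close> with
  least strict upper bound \<open>m\<close> is removed, the points that were sent to \<open>p\<close> are
  sent to \<open>m\<close>.\<close>
lemma ubp_retract_least_above:
  assumes "ubp_retract X A" and "x \<in> topspace X"
  shows "\<exists>a\<in>A. pt_le X x a \<and> (\<forall>b\<in>A. pt_le X x b \<longrightarrow> pt_le X a b)"
  using assms
proof (induction rule: ubp_retract.induct)
  case ubp_refl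
  then show ?case by (auto simp: pt_le_def)
next
  case (ubp_step A p)
  then obtain a where a: "a \<in> A" "pt_le X x a" "\<And>b. b \<in> A \<Longrightarrow> pt_le X x b \<Longrightarrow> pt_le X a b"
    by blast
  obtain m where m: "m \<in> A" "m \<noteq> p" "pt_le X p m"
    "\<And>z. z \<in> A \<Longrightarrow> z \<noteq> p \<Longrightarrow> pt_le X p z \<Longrightarrow> pt_le X m z"
    using ubp_step.hyps(2) unfolding up_beat_point_def F_hat_def by (auto simp: pt_le_subtopology)
  show ?case
  proof (cases "a = p")
    case True
    then show ?thesis using a m pt_le_trans[of X x p m] by (intro bexI[of _ m]) auto
  next
    case False
    then show ?thesis using a by blast
  qed
qed

lemma ubp_retract_mxl_subset:
  assumes "ubp_retract X A"
  shows "mxl X \<subseteq> A"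
proof
  fix x assume "x \<in> mxl X"
  then show "x \<in> A"
    using ubp_retract_least_above[OF assms, of x] by (auto simp: mxl_def)
qed

section \<open>Traces on an up-beat-point retract\<close>

lemma homeomorphic_map_downset_topology:
  assumes onto: "f ` P = Q"
    and order: "\<And>C D. C \<in> P \<Longrightarrow> D \<in> P \<Longrightarrow> f C \<subseteq> f D \<longleftrightarrow> C \<subseteq> D"
  shows "homeomorphic_map (downset_topology P) (downset_topology Q) f"
proof -
  have inj: "inj_on f P" using order by (intro inj_onI) blast
  have image_open: "openin (downset_topology Q) (f ` S) \<longleftrightarrow> openin (downset_topology P) S"
    if "S \<subseteq> P" for S
  proof -
    have "(\<forall>D\<in>Q. D \<subseteq> f C \<longrightarrow> D \<in> f ` S) \<longleftrightarrow> (\<forall>D\<in>P. D \<subseteq> C \<longrightarrow> D \<in> S)" if "C \<in> S" for C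
      using that \<open>S \<subseteq> P\<close> order inj unfolding onto[symmetric]
      by (auto simp: inj_on_image_mem_iff subset_iff[of S P])
    then show ?thesis
      using that onto by (auto simp: openin_downset_topology)
  qed
  have "openin (downset_topology P) {C \<in> P. f C \<in> T} \<longleftrightarrow> openin (downset_topology Q) T"
    if "T \<subseteq> Q" for T
  proof -
    have "f ` {C \<in> P. f C \<in> T} = T" using that onto by blast
    then show ?thesis using image_open[of "{C \<in> P. f C \<in> T}"] by simp
  qed
  then show ?thesis
    using onto inj
    by (simp add: homeomorphic_map_def quotient_map_def topspace_downset_topology)
qed

context comparable_retraction
begin

text \<open>To see that traces on \<open>A\<close> reflect inclusion, each point of \<open>C\<close> is moved up into
  \<open>C \<inter> A\<close>; the intersection containing \<open>D\<close> is a down-set, so membership comes back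
  down.\<close>
lemma homeomorphic_map_UU_map_retraction:
  assumes "ubp_retract X A"
  shows "homeomorphic_map (UU_space X) (UU_space (subtopology X A)) (UU_map X (subtopology X A) r)"
  unfolding UU_space_def
proof (rule homeomorphic_map_downset_topology)
  show "UU_map X (subtopology X A) r ` UU X = UU (subtopology X A)"
  proof
    show "UU_map X (subtopology X A) r ` UU X \<subseteq> UU (subtopology X A)"
      using UU_map_retraction_eq_Int component_Int_in_UU by auto
    show "UU (subtopology X A) \<subseteq> UU_map X (subtopology X A) r ` UU X"
    proof
      fix D assume D: "D \<in> UU (subtopology X A)"
      show "D \<in> UU_map X (subtopology X A) r ` UU X"
        using UU_map_inclusion_least(1,2)[OF D] UU_map_retraction_eq_Int
        by (intro image_eqI[of _ _ "UU_map (subtopology X A) X id D"]) simp_all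
    qed
  qed
next
  fix C D assume C: "C \<in> UU X" and D: "D \<in> UU X"
  have "C \<subseteq> D" if CD: "C \<inter> A \<subseteq> D \<inter> A"
  proof -
    obtain B where B: "B \<noteq> {}" "B \<subseteq> mxl X" and C': "connectedin X C" "C \<noteq> {}" "C \<subseteq> U_set X B"
      and maxC: "\<And>S. connectedin X S \<Longrightarrow> S \<inter> C \<noteq> {} \<Longrightarrow> S \<subseteq> U_set X B \<Longrightarrow> S \<subseteq> C"
      using C by (rule UU_E) blast
    obtain B' where B': "B' \<noteq> {}" "B' \<subseteq> mxl X" and DB: "D \<subseteq> U_set X B'"
      and maxD: "\<And>S. connectedin X S \<Longrightarrow> S \<inter> D \<noteq> {} \<Longrightarrow> S \<subseteq> U_set X B' \<Longrightarrow> S \<subseteq> D"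
      using D by (rule UU_E) blast
    have "x \<in> U_set X B'" if x: "x \<in> C" for x
    proof -
      have xB: "x \<in> U_set X B" using x C' by blast
      then have "x \<in> topspace X" using U_set_subset_topspace[OF B] by blast
      then obtain a where a: "a \<in> A" "pt_le X x a" "\<forall>b\<in>A. pt_le X x b \<longrightarrow> pt_le X a b"
        using ubp_retract_least_above[OF assms] by blast
      \<comment> \<open>every \<open>b \<in> B\<close> is a point of \<open>A\<close> above \<open>x\<close>, and \<open>a\<close> is the least such point\<close>
      have aB: "a \<in> U_set X B"
        using a xB B mxl_sub by (auto simp: mem_U_set_iff[OF B(2)])
      have "{x, a} \<subseteq> C"
        using maxC[OF connectedin_comparable[OF a(2)]] x xB aB by blast
      then have "a \<in> U_set X B'" using a CD DB by blast
      then show ?thesis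
        using pt_le_trans[OF a(2)] by (simp add: mem_U_set_iff[OF B'(2)])
    qed
    moreover have "C \<inter> D \<noteq> {}" using image_component_eq_Int[OF C] C' CD by blast
    ultimately show ?thesis using maxD[OF C'(1)] by blast
  qed
  then show "UU_map X (subtopology X A) r C \<subseteq> UU_map X (subtopology X A) r D \<longleftrightarrow> C \<subseteq> D"
    using C D UU_map_retraction_eq_Int by auto
qed

end

theorem proposition6p3:
  fixes X :: "'a topology" and A :: "'a set" and r :: "'a \<Rightarrow> 'a"
  assumes "finite (topspace X)"
    and "t0_space X"
    and "bp_retract X A"
    and "bp_retraction X A r"
  shows "(mxl X \<subseteq> A \<longrightarrow>
            (\<forall>C \<in> UU X. UU_map X (subtopology X A) r C = r ` C) \<and>
            (\<forall>C \<in> UU (subtopology X A).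
               UU_map X (subtopology X A) r (UU_map (subtopology X A) X id C) = C)) \<and>
         (ubp_retract X A \<longrightarrow>
            homeomorphic_map (UU_space X) (UU_space (subtopology X A))
              (UU_map X (subtopology X A) r)) \<and>
         (mxl X \<subseteq> A \<and> dbp_retract X A \<longrightarrow>
            (\<forall>C \<in> UU X.
               UU_map (subtopology X A) X id (UU_map X (subtopology X A) r C) \<subseteq> C))"
proof -
  have sub: "A \<subseteq> topspace X"
    using assms(3) dbp_retract_subset ubp_retract_subset unfolding bp_retract_def by blast
  have loc: "comparable_retraction X A r" if "mxl X \<subseteq> A"
    using assms sub that
    by unfold_locales (auto simp: bp_retraction_def retraction_maps_def)
  show ?thesis
  proof (intro conjI impI ballI)
    fix C assume "mxl X \<subseteq> A" and C: "C \<in> UU X"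
    then interpret comparable_retraction X A r using loc by blast
    show "UU_map X (subtopology X A) r C = r ` C"
      using C UU_map_retraction_eq_Int image_component_eq_Int by simp
  next
    fix C assume "mxl X \<subseteq> A" and C: "C \<in> UU (subtopology X A)"
    then interpret comparable_retraction X A r using loc by blast
    show "UU_map X (subtopology X A) r (UU_map (subtopology X A) X id C) = C"
      using UU_map_inclusion_least(1,2)[OF C] UU_map_retraction_eq_Int by simp
  next
    assume u: "ubp_retract X A"
    then interpret comparable_retraction X A r using loc ubp_retract_mxl_subset by blast
    show "homeomorphic_map (UU_space X) (UU_space (subtopology X A)) (UU_map X (subtopology X A) r)"
      using u by (rule homeomorphic_map_UU_map_retraction)
  next
    fix C assume "mxl X \<subseteq> A \<and> dbp_retract X A" and C: "C \<in> UU X"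
    then interpret comparable_retraction X A r using loc by blast
    show "UU_map (subtopology X A) X id (UU_map X (subtopology X A) r C) \<subseteq> C"
      using C UU_map_inclusion_least(3) UU_map_retraction_eq_Int component_Int_in_UU by simp
  qed
qed

end
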